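(* Let $n\geq 1$. Then $$\mathcal{C}_N(S^n\times T^2)\leq\sqrt{\tfrac{9}{5}}\qquad\text{for all } N\geq 4n+16.$$
   Context: $T^2=S^1\times S^1$ is the 2-torus and $\mathbb{B}^N\subset\mathbb{R}^N$ denotes the closed unit ball. For a smooth immersion $f:X\to\mathbb{B}^N$ with (vector-valued) second fundamental form $\mathbf{A}$ in $\mathbb{R}^N$, the maximal normal curvature is $\mathfrak{c}(f):=\sup_{|u|=1}|\mathbf{A}(u,u)|$, the supremum being over all tangent vectors $u$ to $X$ of unit length with respect to the pullback metric $g=f^*g_{\mathbb{R}^N}$. The minimal curvature invariant is $\mathcal{C}_N(X):=\inf\mathfrak{c}(f)$, the infimum being over all smooth immersions $f:X\to\mathbb{B}^N$. *)

theory Defs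
  imports "HOL-Analysis.Analysis"
begin

text \<open>
  Smooth manifolds are represented as embedded submanifolds \<open>M\<close> of a Euclidean space.
  Maps on \<open>M\<close> are total functions on the ambient space; the notions taking \<open>M\<close> as an
  argument depend only on their values on \<open>M\<close>. The predicates \<open>Ck_on\<close> and \<open>smooth_on\<close> are
  meant for open sets.
\<close>

primrec Ck_on :: "nat \<Rightarrow> 'a::euclidean_space set \<Rightarrow> ('a \<Rightarrow> 'b::euclidean_space) \<Rightarrow> bool" where
  "Ck_on 0 S f \<longleftrightarrow> continuous_on S f"
| "Ck_on (Suc k) S f \<longleftrightarrow>
     (\<forall>x\<in>S. f differentiable (at x)) \<and>
     (\<forall>v. Ck_on k S (\<lambda>x. frechet_derivative f (at x) v))"

definition smooth_on :: "'a::euclidean_space set \<Rightarrow> ('a \<Rightarrow> 'b::euclidean_space) \<Rightarrow> bool" where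
  "smooth_on S f \<longleftrightarrow> (\<forall>k. Ck_on k S f)"

definition smooth_map_on :: "'a::euclidean_space set \<Rightarrow> ('a \<Rightarrow> 'b::euclidean_space) \<Rightarrow> bool" where
  "smooth_map_on M f \<longleftrightarrow>
     (\<forall>p\<in>M. \<exists>U F. open U \<and> p \<in> U \<and> smooth_on U F \<and> (\<forall>x\<in>M \<inter> U. F x = f x))"

definition tangent_space :: "'a::euclidean_space set \<Rightarrow> 'a \<Rightarrow> 'a set" where
  "tangent_space M p =
     {v. \<exists>\<gamma> e. e > 0 \<and> smooth_on {-e<..<e} \<gamma> \<and> \<gamma> ` {-e<..<e} \<subseteq> M \<and>
            \<gamma> (0::real) = p \<and> (\<gamma> has_vector_derivative v) (at 0)}"

text \<open>
  The derivative of \<open>f\<close> at \<open>p\<close> within \<open>M\<close> is not unique as a linear map on the ambient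
  space, but its restriction to the tangent space is; see \<open>differential_eq\<close> below.
\<close>

definition differential ::
  "'a::euclidean_space set \<Rightarrow> ('a \<Rightarrow> 'b::euclidean_space) \<Rightarrow> 'a \<Rightarrow> 'a \<Rightarrow> 'b" where
  "differential M f p u = frechet_derivative f (at p within M) u"

lemma differential_eq:
  fixes f :: "'a::euclidean_space \<Rightarrow> 'b::euclidean_space"
  assumes D: "(f has_derivative D) (at p within M)"
    and u: "u \<in> tangent_space M p"
  shows "differential M f p u = D u"
proof -
  obtain \<gamma> :: "real \<Rightarrow> 'a" and e where e: "e > 0" and im: "\<gamma> ` {-e<..<e} \<subseteq> M"
    and 0: "\<gamma> 0 = p" and d: "(\<gamma> has_vector_derivative u) (at 0)"
    using u unfolding tangent_space_def by blast
  have curve: "((f \<circ> \<gamma>) has_vector_derivative E u) (at 0)"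
    if E: "(f has_derivative E) (at p within M)" for E
  proof -
    have "((f \<circ> \<gamma>) has_vector_derivative E u) (at 0 within {-e<..<e})"
    proof (rule vector_derivative_diff_chain_within)
      show "(\<gamma> has_vector_derivative u) (at 0 within {-e<..<e})"
        using d by (rule has_vector_derivative_at_within)
      show "(f has_derivative E) (at (\<gamma> 0) within \<gamma> ` {-e<..<e})"
        using E im unfolding 0 by (rule has_derivative_subset)
    qed
    moreover have "at (0::real) within {-e<..<e} = at 0"
      using e by (intro at_within_open) auto
    ultimately show ?thesis by simp
  qed
  have "(f has_derivative frechet_derivative f (at p within M)) (at p within M)"
    using D by (metis differentiable_def frechet_derivative_works)
  from vector_derivative_unique_at[OF curve[OF this] curve[OF D]]
  show ?thesis by (simp add: differential_def)
qed

definition immersion_on :: "'a::euclidean_space set \<Rightarrow> ('a \<Rightarrow> 'b::euclidean_space) \<Rightarrow> bool" where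
  "immersion_on M f \<longleftrightarrow>
     smooth_map_on M f \<and> (\<forall>p\<in>M. inj_on (differential M f p) (tangent_space M p))"

definition normal_part :: "'b::euclidean_space set \<Rightarrow> 'b \<Rightarrow> 'b" where
  "normal_part L w = (THE z. z \<in> L\<^sup>\<bottom> \<and> w - z \<in> L)"

definition tangent_field :: "'a::euclidean_space set \<Rightarrow> ('a \<Rightarrow> 'a) \<Rightarrow> bool" where
  "tangent_field M V \<longleftrightarrow> smooth_map_on M V \<and> (\<forall>x\<in>M. V x \<in> tangent_space M x)"

text \<open>
  \<open>A\<^sub>p(u,v)\<close> is the component normal to the image of the derivative at \<open>u\<close> of the vector field
  \<open>df(V)\<close> along \<open>f\<close>, where \<open>V\<close> is a tangent field on \<open>M\<close> extending \<open>v\<close>.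
  For an immersion the result does not depend on the choice of \<open>V\<close>.
\<close>

definition second_fundamental_form ::
  "'a::euclidean_space set \<Rightarrow> ('a \<Rightarrow> 'b::euclidean_space) \<Rightarrow> 'a \<Rightarrow> 'a \<Rightarrow> 'a \<Rightarrow> 'b" where
  "second_fundamental_form M f p u v =
     (let V = (SOME V. tangent_field M V \<and> V p = v)
      in normal_part (differential M f p ` tangent_space M p)
           (differential M (\<lambda>x. differential M f x (V x)) p u))"

text \<open>
  Extended reals make the supremum and the infimum below meaningful without side conditions;
  in particular an infimum over no immersions is \<open>\<infinity>\<close>. The length of \<open>u\<close> in the
  pullback metric is the norm of \<open>differential M f p u\<close>.
\<close>

definition max_normal_curvature ::
  "'a::euclidean_space set \<Rightarrow> ('a \<Rightarrow> 'b::euclidean_space) \<Rightarrow> ereal" where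
  "max_normal_curvature M f =
     (SUP (p, u) \<in> {(p, u). p \<in> M \<and> u \<in> tangent_space M p \<and> norm (differential M f p u) = 1}.
        ereal (norm (second_fundamental_form M f p u u)))"

definition minimal_curvature :: "'b::euclidean_space itself \<Rightarrow> 'a::euclidean_space set \<Rightarrow> ereal" where
  "minimal_curvature _ M =
     (INF f \<in> {f :: 'a \<Rightarrow> 'b. immersion_on M f \<and> f ` M \<subseteq> cball 0 1}. max_normal_curvature M f)"

end

theory Submission
  imports Defs
begin

text \<open>
  A map of the flat 3-torus whose components are the characters of frequencies \<open>k\<^sub>j\<close> with weights
  \<open>w\<^sub>j\<close>, \<open>\<Sum>w\<^sub>j = 1\<close>, has metric \<open>\<Sum>w\<^sub>j\<langle>k\<^sub>j,u\<rangle>\<^sup>2\<close> and \<open>|A(u,u)|\<^sup>2 = \<Sum>w\<^sub>j\<langle>k\<^sub>j,u\<rangle>\<^sup>4\<close>. If the \<open>k\<^sub>j\<close> form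
  a weighted spherical 4-design (with respect to that metric) of radius \<open>\<surd>3\<close>, then \<open>|A(u,u)|\<^sup>2 = 9/5\<close>
  for every unit vector \<open>u\<close>. Choose such a design in which the first coordinate of every frequency is
  \<open>0\<close> or \<open>\<plusminus>1\<close>, with two equally weighted pairs \<open>(\<plusminus>1, a)\<close> of the second kind and six frequencies (up to
  sign) of the first kind. Up to an isometry a pair contributes \<open>cos t \<cdot> e\<close> and \<open>sin t \<cdot> e\<close> for the
  character \<open>e\<close> of frequency \<open>a\<close> on the 2-torus; replacing \<open>(cos t, sin t)\<close> by a point of the
  sphere gives a map into a space of dimension \<open>2 \<cdot> 2(n+1) + 2 \<cdot> 6 = 4n + 16\<close> which restricts to the
  map of the 3-torus on each product of a great circle with the 2-torus. Every tangent vector is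
  tangent to such a product.
\<close>

subsection \<open>Closure properties of smooth maps\<close>

text \<open>\<open>frechet_derivative\<close> at a point depends only on the germ of the function
  there, and on an open set equality on the set is equality of germs; this passes to derivatives of
  every order.\<close>

lemma Ck_on_cong:
  assumes "open S" "\<And>x. x \<in> S \<Longrightarrow> f x = g x" "Ck_on k S f"
  shows "Ck_on k S g"
  using assms(2,3)
proof (induction k arbitrary: f g)
  case 0
  then show ?case by (simp cong: continuous_on_cong)
next
  case (Suc k)
  have D: "(g has_derivative frechet_derivative f (at x)) (at x)" if "x \<in> S" for x
  proof (rule has_derivative_transform_within_open[OF _ assms(1) that])
    show "(f has_derivative frechet_derivative f (at x)) (at x)"
      using Suc.prems(2) that by (simp add: frechet_derivative_works)
  qed (use Suc.prems(1) in blast)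
  have "Ck_on k S (\<lambda>x. frechet_derivative g (at x) v)" for v
  proof (rule Suc.IH)
    show "Ck_on k S (\<lambda>x. frechet_derivative f (at x) v)"
      using Suc.prems(2) by simp
    show "frechet_derivative f (at x) v = frechet_derivative g (at x) v" if "x \<in> S" for x
      using frechet_derivative_at[OF D[OF that]] by simp
  qed
  then show ?case
    unfolding Ck_on.simps differentiable_def using D by blast
qed

text \<open>Uniqueness of the derivative at an interior point lets an explicit formula
  \<open>f'\<close> replace \<open>frechet_derivative\<close>. All inductions on the order of
  differentiability below run through this rule.\<close>

lemma Ck_on_SucI:
  assumes "open S" "\<And>x. x \<in> S \<Longrightarrow> (f has_derivative f' x) (at x)"
    "\<And>v. Ck_on k S (\<lambda>x. f' x v)"
  shows "Ck_on (Suc k) S f"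
proof -
  have "Ck_on k S (\<lambda>x. frechet_derivative f (at x) v)" for v
    by (rule Ck_on_cong[OF assms(1) _ assms(3)[of v]])
       (use frechet_derivative_at[OF assms(2)] in simp)
  then show ?thesis
    unfolding Ck_on.simps differentiable_def using assms(2) by blast
qed

lemma Ck_on_Suc_has_derivative:
  assumes "Ck_on (Suc k) S f" "x \<in> S"
  shows "(f has_derivative frechet_derivative f (at x)) (at x)"
  using assms by (simp add: frechet_derivative_works)

lemma Ck_on_SucD: "Ck_on (Suc k) S f \<Longrightarrow> Ck_on k S f"
proof (induction k arbitrary: f)
  case 0
  then show ?case
    by (simp add: continuous_at_imp_continuous_on differentiable_imp_continuous_within)
next
  case (Suc k)
  then show ?case by simp
qed

lemma Ck_on_const: "open S \<Longrightarrow> Ck_on k S (\<lambda>x. c)"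
proof (induction k arbitrary: c)
  case (Suc k)
  show ?case
    by (rule Ck_on_SucI[OF Suc.prems, where f' = "\<lambda>x v. 0"]) (use Suc in auto)
qed simp

lemma Ck_on_bounded_linear:
  assumes "open S" "bounded_linear h"
  shows "Ck_on k S h"
proof (cases k)
  case 0
  then show ?thesis by (simp add: assms(2) linear_continuous_on)
next
  case (Suc j)
  show ?thesis unfolding Suc
    by (rule Ck_on_SucI[OF assms(1), where f' = "\<lambda>x. h"])
       (use assms in \<open>auto simp: bounded_linear_imp_has_derivative intro: Ck_on_const\<close>)
qed

lemma Ck_on_add:
  "open S \<Longrightarrow> Ck_on k S f \<Longrightarrow> Ck_on k S g \<Longrightarrow> Ck_on k S (\<lambda>x. f x + g x)"
proof (induction k arbitrary: f g)
  case 0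
  then show ?case by (simp add: continuous_on_add)
next
  case (Suc k)
  show ?case
    by (rule Ck_on_SucI[OF Suc.prems(1) has_derivative_add])
       (use Suc in \<open>auto intro: Ck_on_Suc_has_derivative\<close>)
qed

lemma Ck_on_linear_compose:
  "bounded_linear h \<Longrightarrow> open S \<Longrightarrow> Ck_on k S f \<Longrightarrow> Ck_on k S (\<lambda>x. h (f x))"
proof (induction k arbitrary: f)
  case 0
  then show ?case by (simp add: bounded_linear.continuous_on)
next
  case (Suc k)
  show ?case
    by (rule Ck_on_SucI[OF Suc.prems(2) bounded_linear.has_derivative[OF Suc.prems(1)]])
       (use Suc in \<open>auto intro: Ck_on_Suc_has_derivative\<close>)
qed

text \<open>The product rule yields two products, each of one differentiated factor with the other
  original factor; the latter is weakened by one order so that the induction hypothesis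
  applies.\<close>

lemma Ck_on_bilinear:
  assumes "bounded_bilinear bop" "open S"
  shows "Ck_on k S f \<Longrightarrow> Ck_on k S g \<Longrightarrow> Ck_on k S (\<lambda>x. bop (f x) (g x))"
proof (induction k arbitrary: f g)
  case 0
  then show ?case by (simp add: bounded_bilinear.continuous_on[OF assms(1)])
next
  case (Suc k)
  show ?case
  proof (rule Ck_on_SucI[OF assms(2)])
    show "((\<lambda>x. bop (f x) (g x)) has_derivative
        (\<lambda>v. bop (f x) (frechet_derivative g (at x) v) + bop (frechet_derivative f (at x) v) (g x)))
        (at x)" if "x \<in> S" for x
      by (rule bounded_bilinear.FDERIV[OF assms(1)
            Ck_on_Suc_has_derivative[OF Suc.prems(1) that] Ck_on_Suc_has_derivative[OF Suc.prems(2) that]])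
    show "Ck_on k S (\<lambda>x. bop (f x) (frechet_derivative g (at x) v) +
        bop (frechet_derivative f (at x) v) (g x))" for v
      using Suc.prems Ck_on_SucD[OF Suc.prems(1)] Ck_on_SucD[OF Suc.prems(2)]
      by (intro Ck_on_add assms(2) Suc.IH) auto
  qed
qed

lemma smooth_on_const: "open S \<Longrightarrow> smooth_on S (\<lambda>x. c)"
  and smooth_on_bounded_linear: "open S \<Longrightarrow> bounded_linear h \<Longrightarrow> smooth_on S h"
  and smooth_on_add:
    "open S \<Longrightarrow> smooth_on S f \<Longrightarrow> smooth_on S g \<Longrightarrow> smooth_on S (\<lambda>x. f x + g x)"
  and smooth_on_linear_compose:
    "bounded_linear h' \<Longrightarrow> open S \<Longrightarrow> smooth_on S f \<Longrightarrow> smooth_on S (\<lambda>x. h' (f x))"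
  and smooth_on_bilinear:
    "bounded_bilinear bop \<Longrightarrow> open S \<Longrightarrow> smooth_on S f1 \<Longrightarrow> smooth_on S f2 \<Longrightarrow>
      smooth_on S (\<lambda>x. bop (f1 x) (f2 x))"
  unfolding smooth_on_def
  by (auto intro: Ck_on_const Ck_on_bounded_linear Ck_on_add Ck_on_linear_compose Ck_on_bilinear)

lemma smooth_on_subset: "smooth_on S f \<Longrightarrow> T \<subseteq> S \<Longrightarrow> smooth_on T f"
proof -
  have "Ck_on k S g \<Longrightarrow> T \<subseteq> S \<Longrightarrow> Ck_on k T g" for k and g :: "'a \<Rightarrow> 'b"
    by (induction k arbitrary: g) (auto intro: continuous_on_subset)
  then show "smooth_on S f \<Longrightarrow> T \<subseteq> S \<Longrightarrow> smooth_on T f"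
    by (auto simp: smooth_on_def)
qed

lemma smooth_on_power:
  fixes f :: "'a::euclidean_space \<Rightarrow> complex"
  shows "open S \<Longrightarrow> smooth_on S f \<Longrightarrow> smooth_on S (\<lambda>x. f x ^ n)"
  by (induction n) (auto intro: smooth_on_const smooth_on_bilinear[OF bounded_bilinear_mult])

lemma smooth_on_Pair:
  fixes f :: "'a::euclidean_space \<Rightarrow> 'b::euclidean_space"
    and g :: "'a \<Rightarrow> 'c::euclidean_space"
  assumes "open S" "smooth_on S f" "smooth_on S g"
  shows "smooth_on S (\<lambda>x. (f x, g x))"
proof -
  have "smooth_on S (\<lambda>x. (f x, 0 :: 'c) + (0 :: 'b, g x))"
    by (intro smooth_on_add assms
        smooth_on_linear_compose[of "\<lambda>y. (y, 0)"] smooth_on_linear_compose[of "\<lambda>y. (0, y)"])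
       (auto intro: bounded_linear_intros)
  then show ?thesis by simp
qed

lemma smooth_on_has_derivative:
  "smooth_on S f \<Longrightarrow> x \<in> S \<Longrightarrow> (f has_derivative frechet_derivative f (at x)) (at x)"
  unfolding smooth_on_def by (metis Ck_on_Suc_has_derivative)

lemma smooth_on_frechet_derivative:
  "smooth_on S f \<Longrightarrow> smooth_on S (\<lambda>x. frechet_derivative f (at x) v)"
  unfolding smooth_on_def by (metis Ck_on.simps(2))

lemma smooth_map_onI: "smooth_on UNIV f \<Longrightarrow> smooth_map_on M f"
  unfolding smooth_map_on_def by (metis open_UNIV UNIV_I)

subsection \<open>Spheres and their products\<close>

text \<open>For a unit vector \<open>p\<close> and \<open>v\<close> orthogonal to \<open>p\<close>
  this is the geodesic of the unit sphere from \<open>p\<close> with initial velocity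
  \<open>v\<close>. For \<open>v = 0\<close> the second summand vanishes and the curve is
  constant.\<close>

definition great_circle :: "'a::euclidean_space \<Rightarrow> 'a \<Rightarrow> real \<Rightarrow> 'a" where
  "great_circle p v t = cos (norm v * t) *\<^sub>R p + sin (norm v * t) *\<^sub>R (v /\<^sub>R norm v)"

text \<open>Differentiation sends the coefficients \<open>(a, b)\<close> to
  \<open>(c b, - c a)\<close> and keeps the form of the curve, so induction over arbitrary
  \<open>a\<close> and \<open>b\<close> closes.\<close>

lemma smooth_on_trig: "smooth_on S (\<lambda>t::real. cos (c * t) *\<^sub>R a + sin (c * t) *\<^sub>R b)"
proof -
  have "Ck_on k UNIV (\<lambda>t::real. cos (c * t) *\<^sub>R a + sin (c * t) *\<^sub>R b)" for k
  proof (induction k arbitrary: a b)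
    case 0
    then show ?case by (auto intro!: continuous_intros)
  next
    case (Suc k)
    show ?case
    proof (rule Ck_on_SucI)
      show "((\<lambda>t. cos (c * t) *\<^sub>R a + sin (c * t) *\<^sub>R b) has_derivative
          (\<lambda>h. h *\<^sub>R (cos (c * t) *\<^sub>R (c *\<^sub>R b) + sin (c * t) *\<^sub>R (- c *\<^sub>R a)))) (at t)" for t
        by (auto intro!: derivative_eq_intros simp: algebra_simps)
      show "Ck_on k UNIV (\<lambda>t. h *\<^sub>R (cos (c * t) *\<^sub>R (c *\<^sub>R b) + sin (c * t) *\<^sub>R (- c *\<^sub>R a)))" for h
        by (intro Ck_on_linear_compose[OF bounded_linear_scaleR_right] Suc.IH) auto
    qed auto
  qed
  then have "smooth_on UNIV (\<lambda>t::real. cos (c * t) *\<^sub>R a + sin (c * t) *\<^sub>R b)"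
    by (simp add: smooth_on_def)
  then show ?thesis by (rule smooth_on_subset) simp
qed

lemma great_circle_0 [simp]: "great_circle p v 0 = p"
  by (simp add: great_circle_def)

lemma great_circle_has_vector_derivative:
  "(great_circle p v has_vector_derivative
      cos (norm v * t) *\<^sub>R v - sin (norm v * t) *\<^sub>R (norm v *\<^sub>R p)) (at t)"
proof -
  have "(great_circle p v has_derivative
      (\<lambda>h. h *\<^sub>R (cos (norm v * t) *\<^sub>R (norm v *\<^sub>R (v /\<^sub>R norm v))
        - sin (norm v * t) *\<^sub>R (norm v *\<^sub>R p)))) (at t)"
    unfolding great_circle_def
    by (auto intro!: derivative_eq_intros simp: algebra_simps)
  moreover have "norm v *\<^sub>R (v /\<^sub>R norm v) = v" by (cases "v = 0") auto
  ultimately show ?thesis unfolding has_vector_derivative_def by (simp only:)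
qed

lemma great_circle_on_sphere:
  assumes "norm p = 1" "v \<bullet> p = 0"
  shows "great_circle p v t \<in> sphere 0 1"
proof -
  have pp: "p \<bullet> p = 1" using assms by (simp add: norm_eq_1)
  have "great_circle p v t \<bullet> great_circle p v t = (cos (norm v * t))\<^sup>2 + (sin (norm v * t))\<^sup>2"
  proof (cases "v = 0")
    case False
    then have "v \<bullet> v / (norm v * norm v) = 1" by (simp add: dot_square_norm power2_eq_square)
    with pp assms(2) show ?thesis
      by (simp add: great_circle_def inner_add_left inner_add_right inner_commute
          power2_eq_square divide_simps)
  qed (simp add: great_circle_def pp)
  then show ?thesis by (simp add: norm_eq_1)
qed

text \<open>Differentiating \<open>\<gamma> t \<bullet> \<gamma> t = 1\<close> gives orthogonality
  to \<open>p\<close>; conversely, great circles realise every orthogonal vector as a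
  velocity.\<close>

lemma tangent_space_sphere:
  assumes "p \<in> sphere 0 1"
  shows "tangent_space (sphere 0 1) p = {v. v \<bullet> p = 0}"
proof (intro equalityI subsetI)
  fix v assume "v \<in> tangent_space (sphere 0 1) p"
  then obtain \<gamma> e where e: "e > 0" and im: "\<gamma> ` {-e<..<e} \<subseteq> sphere 0 1" and 0: "\<gamma> (0::real) = p"
    and d: "(\<gamma> has_vector_derivative v) (at 0)"
    unfolding tangent_space_def by blast
  have "((\<lambda>t. \<gamma> t \<bullet> \<gamma> t) has_derivative (\<lambda>h. 2 * h * (v \<bullet> p))) (at 0)"
    using d unfolding has_vector_derivative_def
    by (auto intro!: derivative_eq_intros simp: 0 inner_commute)
  moreover have "((\<lambda>t. \<gamma> t \<bullet> \<gamma> t) has_derivative (\<lambda>h. 0)) (at 0)"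
  proof (rule has_derivative_transform_within_open[OF has_derivative_const])
    show "1 = \<gamma> t \<bullet> \<gamma> t" if "t \<in> {-e<..<e}" for t
      using imageI[OF that, of \<gamma>] im by (auto simp: norm_eq_1 subset_iff)
  qed (use e in auto)
  ultimately have "(\<lambda>h. 2 * h * (v \<bullet> p)) = (\<lambda>h. 0)" by (rule has_derivative_unique)
  from fun_cong[OF this, of 1] show "v \<in> {v. v \<bullet> p = 0}" by simp
next
  fix v assume "v \<in> {v. v \<bullet> p = 0}"
  then have "great_circle p v ` {-1<..<1} \<subseteq> sphere 0 1"
    using great_circle_on_sphere[of p v] assms by auto
  moreover have "smooth_on {-1<..<1} (great_circle p v)"
    unfolding great_circle_def by (rule smooth_on_trig)
  moreover have "(great_circle p v has_vector_derivative v) (at 0)"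
    using great_circle_has_vector_derivative[of p v 0] by simp
  ultimately show "v \<in> tangent_space (sphere 0 1) p"
    unfolding tangent_space_def using great_circle_0 zero_less_one by blast
qed

lemma tangent_space_Times:
  fixes A :: "'a::euclidean_space set" and B :: "'b::euclidean_space set"
  shows "tangent_space (A \<times> B) (p, q) = tangent_space A p \<times> tangent_space B q"
proof (intro equalityI subsetI)
  fix w assume "w \<in> tangent_space (A \<times> B) (p, q)"
  then obtain \<gamma> e where e: "e > 0" and s: "smooth_on {-e<..<e} \<gamma>"
    and im: "\<gamma> ` {-e<..<e} \<subseteq> A \<times> B" and 0: "\<gamma> (0::real) = (p, q)"
    and d: "(\<gamma> has_vector_derivative w) (at 0)"
    unfolding tangent_space_def by blast
  have "fst w \<in> tangent_space A p"
    unfolding tangent_space_def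
    using e im 0 smooth_on_linear_compose[OF bounded_linear_fst _ s]
      bounded_linear.has_vector_derivative[OF bounded_linear_fst d]
    by (intro CollectI exI[of _ "\<lambda>t. fst (\<gamma> t)"] exI[of _ e]) auto
  moreover have "snd w \<in> tangent_space B q"
    unfolding tangent_space_def
    using e im 0 smooth_on_linear_compose[OF bounded_linear_snd _ s]
      bounded_linear.has_vector_derivative[OF bounded_linear_snd d]
    by (intro CollectI exI[of _ "\<lambda>t. snd (\<gamma> t)"] exI[of _ e]) auto
  ultimately show "w \<in> tangent_space A p \<times> tangent_space B q" by (simp add: mem_Times_iff)
next
  fix w assume "w \<in> tangent_space A p \<times> tangent_space B q"
  then obtain u v where w: "w = (u, v)" and u: "u \<in> tangent_space A p"
    and v: "v \<in> tangent_space B q" by blast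
  obtain \<alpha> d where \<alpha>: "d > 0" "smooth_on {-d<..<d} \<alpha>" "\<alpha> ` {-d<..<d} \<subseteq> A" "\<alpha> (0::real) = p"
    "(\<alpha> has_vector_derivative u) (at 0)" using u unfolding tangent_space_def by blast
  obtain \<beta> e where \<beta>: "e > 0" "smooth_on {-e<..<e} \<beta>" "\<beta> ` {-e<..<e} \<subseteq> B" "\<beta> (0::real) = q"
    "(\<beta> has_vector_derivative v) (at 0)" using v unfolding tangent_space_def by blast
  define m where "m = min d e"
  have "smooth_on {-m<..<m} (\<lambda>t. (\<alpha> t, \<beta> t))"
    by (intro smooth_on_Pair smooth_on_subset[OF \<alpha>(2)] smooth_on_subset[OF \<beta>(2)])
       (auto simp: m_def)
  moreover have "(\<lambda>t. (\<alpha> t, \<beta> t)) ` {-m<..<m} \<subseteq> A \<times> B"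
    using \<alpha>(3) \<beta>(3) by (auto simp: m_def image_subset_iff)
  moreover have "((\<lambda>t. (\<alpha> t, \<beta> t)) has_vector_derivative w) (at 0)"
    unfolding w by (intro has_vector_derivative_Pair \<alpha> \<beta>)
  moreover have "m > 0" using \<alpha>(1) \<beta>(1) by (simp add: m_def)
  ultimately show "w \<in> tangent_space (A \<times> B) (p, q)"
    unfolding tangent_space_def using \<alpha>(4) \<beta>(4)
    by (intro CollectI exI[of _ "\<lambda>t. (\<alpha> t, \<beta> t)"] exI[of _ m]) auto
qed

text \<open>At a unit vector \<open>y\<close> this is the orthogonal projection of \<open>v\<close>
  to the tangent space of the sphere. Being polynomial in \<open>y\<close>, it is smooth on the
  whole ambient space and extends a tangent vector to a tangent field.\<close>

definition sphere_projection :: "'a::euclidean_space \<Rightarrow> 'a \<Rightarrow> 'a" where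
  "sphere_projection v y = v + (y \<bullet> (- v)) *\<^sub>R y"

lemma smooth_on_sphere_projection:
  assumes "bounded_linear h"
  shows "smooth_on UNIV (\<lambda>q. sphere_projection v (h q))"
  unfolding sphere_projection_def
  by (intro smooth_on_add smooth_on_const smooth_on_bilinear[OF bounded_bilinear_scaleR]
      smooth_on_bounded_linear bounded_linear_compose[OF bounded_linear_inner_left assms]
      assms open_UNIV)

lemma sphere_projection_orthogonal: "norm y = 1 \<Longrightarrow> sphere_projection v y \<bullet> y = 0"
  by (simp add: sphere_projection_def inner_diff_right inner_commute norm_eq_1)

lemma sphere_projection_id: "v \<bullet> y = 0 \<Longrightarrow> sphere_projection v y = v"
  by (simp add: sphere_projection_def inner_commute)

subsection \<open>The second fundamental form along a curve\<close>

lemma differential_smooth: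
  assumes "smooth_on UNIV f" "u \<in> tangent_space M p"
  shows "differential M f p u = frechet_derivative f (at p) u"
  using has_derivative_at_withinI[OF smooth_on_has_derivative[OF assms(1)]] assms(2)
  by (intro differential_eq) auto

text \<open>A subspace meets its orthogonal complement only in 0, so the decomposition is unique and
  the definite description is well defined.\<close>

lemma normal_part_eq:
  assumes "subspace L" "a \<in> L\<^sup>\<bottom>" "l \<in> L"
  shows "normal_part L (a + l) = a"
  unfolding normal_part_def
proof (rule the_equality)
  show "a \<in> L\<^sup>\<bottom> \<and> a + l - a \<in> L" using assms by simp
  fix z assume z: "z \<in> L\<^sup>\<bottom> \<and> a + l - z \<in> L"
  have "(a + l - z) - l \<in> L" by (rule subspace_diff[OF assms(1)]) (use z assms in auto)
  then have "a - z \<in> L" by (simp add: algebra_simps)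
  moreover have "a - z \<in> L\<^sup>\<bottom>"
    using z assms(2) subspace_diff[OF subspace_orthogonal_comp] by blast
  ultimately have "(a - z) \<bullet> (a - z) = 0"
    by (auto simp: orthogonal_comp_def orthogonal_def)
  then show "z = a" by simp
qed

text \<open>Smoothness controls the derivative of \<open>f\<close> in a fixed direction only;
  expanding the varying direction \<open>G x\<close> in the standard basis reduces to that
  case.\<close>

lemma frechet_derivative_apply_differentiable:
  fixes f :: "'a::euclidean_space \<Rightarrow> 'b::euclidean_space"
  assumes "smooth_on UNIV f" "G differentiable (at p)"
  shows "(\<lambda>x. frechet_derivative f (at x) (G x)) differentiable (at p)"
proof -
  have lin: "linear (frechet_derivative f (at x))" for x
    using smooth_on_has_derivative[OF assms(1)] by (metis UNIV_I has_derivative_linear)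
  have "frechet_derivative f (at x) (G x) =
      (\<Sum>b\<in>Basis. (G x \<bullet> b) *\<^sub>R frechet_derivative f (at x) b)" for x
    by (subst (1) euclidean_representation[of "G x", symmetric])
       (simp add: linear_sum[OF lin] linear_cmul[OF lin])
  moreover have "(\<lambda>x. frechet_derivative f (at x) b) differentiable (at p)" for b
    using smooth_on_has_derivative[OF smooth_on_frechet_derivative[OF assms(1)]]
    by (meson UNIV_I differentiable_def)
  then have "(\<lambda>x. \<Sum>b\<in>Basis. (G x \<bullet> b) *\<^sub>R frechet_derivative f (at x) b) differentiable (at p)"
    using assms(2)
    by (intro differentiable_sum differentiable_scaleR differentiable_inner) auto
  ultimately show ?thesis by simp
qed

text \<open>
  Along a curve \<open>c\<close> with \<open>c'(0) = V(c(0))\<close> the fields \<open>V \<circ> c\<close> and \<open>c'\<close> differ by a tangent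
  field vanishing at \<open>0\<close>, so \<open>df(V)\<close> and \<open>(f \<circ> c)'\<close> have the same derivative at \<open>0\<close> modulo
  the tangent space.
\<close>

lemma second_fundamental_form_eq_curve:
  fixes f :: "'a::euclidean_space \<Rightarrow> 'b::euclidean_space" and c c' :: "real \<Rightarrow> 'a"
  assumes f: "smooth_on UNIV f"
    and T: "\<And>t. subspace (tangent_space M (c t))"
    and ex: "\<exists>V. tangent_field M V \<and> V (c 0) = c' 0"
    and cM: "\<And>t. c t \<in> M" and c'T: "\<And>t. c' t \<in> tangent_space M (c t)"
    and c: "\<And>t. (c has_vector_derivative c' t) (at t)"
    and c': "(c' has_vector_derivative c'') (at 0)"
    and closed: "\<And>D d. \<lbrakk>\<And>t. D t \<in> tangent_space M (c t); D 0 = 0;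
        (D has_vector_derivative d) (at 0)\<rbrakk> \<Longrightarrow> d \<in> tangent_space M (c 0)"
    and fc: "\<And>t. ((\<lambda>t. f (c t)) has_vector_derivative b t) (at t)"
    and b: "(b has_vector_derivative a) (at 0)"
    and normal: "a \<in> (differential M f (c 0) ` tangent_space M (c 0))\<^sup>\<bottom>"
  shows "second_fundamental_form M f (c 0) (c' 0) (c' 0) = a"
proof -
  define V where "V = (SOME V. tangent_field M V \<and> V (c 0) = c' 0)"
  have V: "tangent_field M V" "V (c 0) = c' 0"
    using someI_ex[OF ex] unfolding V_def by auto
  let ?f' = "\<lambda>x. frechet_derivative f (at x)"
  have f': "(f has_derivative ?f' x) (at x)" for x
    by (rule smooth_on_has_derivative[OF f]) simp
  have lin: "linear (?f' x)" for x using f'[of x] by (rule has_derivative_linear)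
  have Vt: "x \<in> M \<Longrightarrow> V x \<in> tangent_space M x" for x
    using V(1) by (simp add: tangent_field_def)
  \<comment> \<open>Smoothness of \<open>V\<close> only provides a smooth \<open>G\<close> near
    \<open>c 0\<close> that agrees with \<open>V\<close> on \<open>M\<close>. Unlike
    \<open>V\<close>, it can be differentiated in the ambient space, so \<open>G\<close> and
    \<open>H\<close> stand in for \<open>V\<close> and \<open>df(V)\<close>.\<close>
  obtain U G where U: "open U" "c 0 \<in> U" and G: "smooth_on U G"
    and GV: "\<And>x. x \<in> M \<inter> U \<Longrightarrow> G x = V x"
    using V(1) cM[of 0] unfolding tangent_field_def smooth_map_on_def by blast
  define H where "H = (\<lambda>x. ?f' x (G x))"
  obtain DG where DG: "(G has_derivative DG) (at (c 0))"
    using smooth_on_has_derivative[OF G U(2)] by blast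
  have "H differentiable (at (c 0))"
    unfolding H_def using frechet_derivative_apply_differentiable[OF f] DG
    by (auto simp: differentiable_def)
  then obtain DH where DH: "(H has_derivative DH) (at (c 0))"
    by (auto simp: differentiable_def)
  obtain r where r: "r > 0" "ball (c 0) r \<subseteq> U" using U by (meson open_contains_ball)
  have "((\<lambda>x. differential M f x (V x)) has_derivative DH) (at (c 0) within M)"
  proof (rule has_derivative_transform_within[OF has_derivative_at_withinI[OF DH] r(1) cM])
    fix x assume "x \<in> M" "dist x (c 0) < r"
    with r GV Vt show "H x = differential M f x (V x)"
      by (auto simp: H_def differential_smooth[OF f] dist_commute subset_iff)
  qed
  then have W: "differential M (\<lambda>x. differential M f x (V x)) (c 0) (c' 0) = DH (c' 0)"
    using c'T by (rule differential_eq)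

  have c0: "(c has_derivative (\<lambda>h. h *\<^sub>R c' 0)) (at 0)"
    using c[of 0] by (simp add: has_vector_derivative_def)
  have DG': "((\<lambda>t. G (c t)) has_vector_derivative DG (c' 0)) (at 0)"
    using has_derivative_compose[OF c0 DG] has_derivative_linear[OF DG]
    by (simp add: has_vector_derivative_def linear_cmul)
  have DH': "((\<lambda>t. H (c t)) has_vector_derivative DH (c' 0)) (at 0)"
    using has_derivative_compose[OF c0 DH] has_derivative_linear[OF DH]
    by (simp add: has_vector_derivative_def linear_cmul)
  \<comment> \<open>\<open>G\<close> and \<open>V\<close> agree along \<open>c\<close> only while
    the curve stays in \<open>U\<close>, which holds for small times.\<close>
  have "open (c -` U)"
    using c U(1) by (intro continuous_open_vimage)
      (auto intro: has_vector_derivative_continuous)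
  then have near: "open (c -` U)" "0 \<in> c -` U" using U(2) by auto
  define d where "d = DG (c' 0) - c''"
  have d: "d \<in> tangent_space M (c 0)"
  proof (rule closed)
    show "V (c t) - c' t \<in> tangent_space M (c t)" for t
      using T Vt[OF cM] c'T by (rule subspace_diff)
    show "V (c 0) - c' 0 = 0" using V(2) by simp
    have "((\<lambda>t. G (c t) - c' t) has_vector_derivative d) (at 0)"
      unfolding d_def by (rule has_vector_derivative_diff[OF DG' c'])
    then show "((\<lambda>t. V (c t) - c' t) has_vector_derivative d) (at 0)"
      by (rule has_vector_derivative_transform_within_open[OF _ near]) (use GV cM in auto)
  qed
  have "b t = ?f' (c t) (c' t)" for t
  proof -
    have "((\<lambda>t. f (c t)) has_vector_derivative ?f' (c t) (c' t)) (at t)"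
      using has_derivative_compose[OF c[unfolded has_vector_derivative_def] f'] lin
      by (simp add: has_vector_derivative_def linear_cmul)
    then show ?thesis using fc vector_derivative_unique_at by blast
  qed
  \<comment> \<open>Along the curve, \<open>df(V)\<close> splits into the velocity \<open>b\<close>
    of the image curve and the image of a field that vanishes at time 0.\<close>
  then have bH: "H (c t) = b t + ?f' (c t) (G (c t) - c' t)" for t
    by (simp add: H_def linear_diff[OF lin])
  define E where "E = (\<lambda>t. G (c t) - c' t)"
  have E0: "E 0 = 0" using GV[of "c 0"] U(2) cM V(2) by (simp add: E_def)
  have E: "(E has_vector_derivative d) (at 0)"
    unfolding E_def d_def by (rule has_vector_derivative_diff[OF DG' c'])
  have f'_sum: "?f' x v = (\<Sum>i\<in>Basis. (v \<bullet> i) *\<^sub>R ?f' x i)" for x v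
    by (subst (1) euclidean_representation[of v, symmetric])
       (simp only: linear_sum[OF lin] linear_cmul[OF lin])
  \<comment> \<open>Since \<open>E 0 = 0\<close>, the product rule loses the term with the second
    derivative of \<open>f\<close>; what remains is the image of \<open>d\<close>, which is
    tangential.\<close>
  have "((\<lambda>t. \<Sum>i\<in>Basis. (E t \<bullet> i) *\<^sub>R ?f' (c t) i) has_vector_derivative
      (\<Sum>i\<in>Basis. (d \<bullet> i) *\<^sub>R ?f' (c 0) i)) (at 0)"
  proof (rule has_vector_derivative_sum)
    fix i :: 'a
    have "((\<lambda>x. ?f' x i) has_derivative frechet_derivative (\<lambda>x. ?f' x i) (at (c 0))) (at (c 0))"
      by (rule smooth_on_has_derivative[OF smooth_on_frechet_derivative[OF f]]) simp
    from has_derivative_compose[OF c0 this]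
    show "((\<lambda>t. (E t \<bullet> i) *\<^sub>R ?f' (c t) i) has_vector_derivative (d \<bullet> i) *\<^sub>R ?f' (c 0) i) (at 0)"
      using E unfolding has_vector_derivative_def
      by (auto intro!: derivative_eq_intros simp: E0)
  qed
  then have "((\<lambda>t. ?f' (c t) (E t)) has_vector_derivative ?f' (c 0) d) (at 0)"
    by (simp only: f'_sum[symmetric])
  from has_vector_derivative_add[OF b this]
  have "((\<lambda>t. H (c t)) has_vector_derivative a + ?f' (c 0) d) (at 0)"
    by (simp add: bH E_def)
  then have DH_eq: "DH (c' 0) = a + ?f' (c 0) d"
    using DH' vector_derivative_unique_at by blast
  define L where "L = differential M f (c 0) ` tangent_space M (c 0)"
  have L: "L = ?f' (c 0) ` tangent_space M (c 0)"
    unfolding L_def by (intro image_cong refl differential_smooth f)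
  have "normal_part L (a + ?f' (c 0) d) = a"
    by (rule normal_part_eq)
      (use L d T lin normal in \<open>auto simp: L_def[symmetric] intro: linear_subspace_image\<close>)
  then show ?thesis
    by (simp add: second_fundamental_form_def V_def[symmetric] W DH_eq L_def[symmetric])
qed

subsection \<open>The spherical design\<close>

text \<open>This is the tensor product of \<open>\<zeta>\<close>, read as a vector of the plane,
  with \<open>x\<close>; hence inner products and norms multiply.\<close>

definition twist :: "complex \<Rightarrow> 'a::euclidean_space \<Rightarrow> 'a \<times> 'a" where
  "twist \<zeta> x = (Re \<zeta> *\<^sub>R x, Im \<zeta> *\<^sub>R x)"

lemma inner_twist: "twist \<zeta> x \<bullet> twist \<eta> y = (\<zeta> \<bullet> \<eta>) * (x \<bullet> y)"
  by (simp add: twist_def inner_complex_def algebra_simps)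

lemma norm_twist: "norm (twist \<zeta> x) = norm \<zeta> * norm x"
  by (simp add: norm_eq_sqrt_inner inner_twist real_sqrt_mult)

lemma bounded_bilinear_twist: "bounded_bilinear twist"
proof
  show "\<exists>K. \<forall>a b. norm (twist a b) \<le> norm a * norm b * K"
    by (intro exI[of _ 1]) (simp add: norm_twist)
qed (simp_all add: twist_def algebra_simps)

text \<open>On the unit circle this is the integer power: conjugation replaces inversion there and
  keeps the map smooth at 0 as well.\<close>

definition cpow :: "complex \<Rightarrow> int \<Rightarrow> complex" where
  "cpow w l = (if l \<ge> 0 then w ^ nat l else cnj w ^ nat (- l))"

lemma cpow_cis_mult: "cpow (cis \<theta> * w) l = cis (of_int l * \<theta>) * cpow w l"
proof -
  have "cis \<theta> ^ nat l = cis (of_int l * \<theta>)" if "l \<ge> 0"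
    using that Complex.DeMoivre[of \<theta> "nat l"] by simp
  moreover have "cis (- \<theta>) ^ nat (- l) = cis (of_int l * \<theta>)" if "\<not> l \<ge> 0"
    using that Complex.DeMoivre[of "- \<theta>" "nat (- l)"] by simp
  ultimately show ?thesis
    unfolding cpow_def by (simp only: power_mult_distrib complex_cnj_mult cis_cnj split: if_split) simp
qed

lemma norm_cpow: "norm w = 1 \<Longrightarrow> norm (cpow w l) = 1"
  by (simp add: cpow_def norm_power)

lemma smooth_on_cpow:
  assumes "open S" "smooth_on S f"
  shows "smooth_on S (\<lambda>x. cpow (f x) l)"
proof (cases "l \<ge> 0")
  case True
  then show ?thesis using smooth_on_power[OF assms] by (simp add: cpow_def)
next
  case False
  then show ?thesis
    using smooth_on_power[OF assms(1) smooth_on_linear_compose[OF bounded_linear_cnj assms]]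
    by (simp add: cpow_def)
qed

definition character :: "complex \<Rightarrow> complex \<Rightarrow> int \<Rightarrow> int \<Rightarrow> complex" where
  "character z w m l = cpow z m * cpow w l"

text \<open>Rotating \<open>z\<close> and \<open>w\<close> at angular speeds \<open>s\<close> and
  \<open>r\<close> rotates a character at the constant speed given by pairing its frequency with
  \<open>(s, r)\<close>.\<close>

lemma character_curve:
  "character (cis (s * t) * z) (cis (r * t) * w) m l =
    cis ((of_int m * s + of_int l * r) * t) * character z w m l"
proof -
  have "cis ((of_int m * s + of_int l * r) * t) = cis (of_int m * (s * t)) * cis (of_int l * (r * t))"
    by (simp add: cis_mult distrib_right mult.assoc)
  then show ?thesis unfolding character_def cpow_cis_mult by (simp add: mult_ac)
qed

lemma norm_character: "norm z = 1 \<Longrightarrow> norm w = 1 \<Longrightarrow> norm (character z w m l) = 1"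
  by (simp add: character_def norm_mult norm_cpow)

section \<open>Uniformly rotating phases and their derivatives\<close>

definition phase :: "complex \<Rightarrow> real \<Rightarrow> real \<Rightarrow> complex" where
  "phase \<zeta> k t = cis (k * t) * \<zeta>"

lemma phase_0 [simp]: "phase \<zeta> k 0 = \<zeta>"
  by (simp add: phase_def)

definition phase_velocity :: "complex \<Rightarrow> real \<Rightarrow> real \<Rightarrow> complex" where
  "phase_velocity \<zeta> k t = \<i> * of_real k * phase \<zeta> k t"

lemma phase_has_vector_derivative:
  "(phase \<zeta> k has_vector_derivative phase_velocity \<zeta> k t) (at t)"
proof -
  have "((\<lambda>u. exp (\<i> * of_real k * u)) has_field_derivative
      \<i> * of_real k * exp (\<i> * of_real k * of_real t)) (at (of_real t))"
    by (auto intro!: derivative_eq_intros)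
  from has_vector_derivative_real_field[OF this]
  have "((\<lambda>t. cis (k * t)) has_vector_derivative \<i> * of_real k * cis (k * t)) (at t)"
    by (simp add: cis_conv_exp mult.assoc)
  from has_vector_derivative_mult_left[OF this, of \<zeta>]
  show ?thesis unfolding phase_velocity_def phase_def by (simp add: mult.assoc)
qed

text \<open>Only the value at time 0 is recorded, whereas the velocity is kept for all times because
  it still has to be differentiated.\<close>

definition phase_acceleration :: "complex \<Rightarrow> real \<Rightarrow> complex" where
  "phase_acceleration \<zeta> k = - (of_real (k\<^sup>2) * \<zeta>)"

lemma phase_velocity_has_vector_derivative:
  "(phase_velocity \<zeta> k has_vector_derivative phase_acceleration \<zeta> k) (at 0)"
  using has_vector_derivative_mult_right[OF phase_has_vector_derivative[of \<zeta> k 0], of "\<i> * of_real k"]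
  by (simp add: phase_velocity_def[abs_def] phase_acceleration_def power2_eq_square mult_ac)

text \<open>Velocity and acceleration are real multiples of \<open>\<i> * \<zeta>\<close> and
  \<open>\<zeta>\<close>, which are orthogonal in the real inner product. The speeds
  \<open>k\<close> and \<open>k'\<close> may differ, as normality has to be tested against all
  tangent vectors.\<close>

lemma inner_phase_velocity_acceleration:
  assumes "norm \<zeta> = 1"
  shows "phase_velocity \<zeta> k 0 \<bullet> phase_velocity \<zeta> k 0 = k\<^sup>2"
    and "phase_acceleration \<zeta> k \<bullet> phase_acceleration \<zeta> k = (k\<^sup>2)\<^sup>2"
    and "phase_velocity \<zeta> k 0 \<bullet> phase_acceleration \<zeta> k' = 0"
proof -
  have *: "(Re \<zeta>)\<^sup>2 + (Im \<zeta>)\<^sup>2 = 1" using assms by (simp add: cmod_power2[symmetric])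
  have "phase_velocity \<zeta> k 0 \<bullet> phase_velocity \<zeta> k 0 = k\<^sup>2 * ((Re \<zeta>)\<^sup>2 + (Im \<zeta>)\<^sup>2)"
    and "phase_acceleration \<zeta> k \<bullet> phase_acceleration \<zeta> k = (k\<^sup>2)\<^sup>2 * ((Re \<zeta>)\<^sup>2 + (Im \<zeta>)\<^sup>2)"
    by (simp_all add: phase_velocity_def phase_acceleration_def inner_complex_def power2_eq_square
        algebra_simps)
  then show "phase_velocity \<zeta> k 0 \<bullet> phase_velocity \<zeta> k 0 = k\<^sup>2"
    and "phase_acceleration \<zeta> k \<bullet> phase_acceleration \<zeta> k = (k\<^sup>2)\<^sup>2" by (simp_all add: *)
  show "phase_velocity \<zeta> k 0 \<bullet> phase_acceleration \<zeta> k' = 0"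
    by (simp add: phase_velocity_def phase_acceleration_def inner_complex_def power2_eq_square)
qed

section \<open>Great circles twisted by a rotating phase\<close>

definition great_circle_velocity :: "'a::euclidean_space \<Rightarrow> 'a \<Rightarrow> real \<Rightarrow> 'a" where
  "great_circle_velocity p v t = cos (norm v * t) *\<^sub>R v - sin (norm v * t) *\<^sub>R (norm v *\<^sub>R p)"

lemma great_circle_velocity_0 [simp]: "great_circle_velocity p v 0 = v"
  by (simp add: great_circle_velocity_def)

lemma great_circle_velocity_has_vector_derivative:
  "(great_circle_velocity p v has_vector_derivative - (norm v)\<^sup>2 *\<^sub>R p) (at 0)"
  unfolding great_circle_velocity_def has_vector_derivative_def
  by (auto intro!: derivative_eq_intros simp: power2_eq_square)

definition twist_velocity :: "complex \<Rightarrow> real \<Rightarrow> 'a::euclidean_space \<Rightarrow> 'a \<Rightarrow> real \<Rightarrow> 'a \<times> 'a" where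
  "twist_velocity \<zeta> k x v t =
    twist (phase \<zeta> k t) (great_circle_velocity x v t) + twist (phase_velocity \<zeta> k t) (great_circle x v t)"

text \<open>Second-order product rule: the accelerations of phase and great circle both point along
  \<open>- twist \<zeta> x\<close>, and the mixed term occurs twice.\<close>

definition twist_acceleration :: "complex \<Rightarrow> real \<Rightarrow> 'a::euclidean_space \<Rightarrow> 'a \<Rightarrow> 'a \<times> 'a" where
  "twist_acceleration \<zeta> k x v =
    twist (- (of_real (k\<^sup>2 + (norm v)\<^sup>2) * \<zeta>)) x + twist (2 * \<i> * of_real k * \<zeta>) v"

lemma twist_has_vector_derivative:
  "((\<lambda>t. twist (phase \<zeta> k t) (great_circle x v t)) has_vector_derivative
    twist_velocity \<zeta> k x v t) (at t)"
  unfolding twist_velocity_def great_circle_velocity_def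
  by (rule bounded_bilinear.has_vector_derivative[OF bounded_bilinear_twist
      phase_has_vector_derivative great_circle_has_vector_derivative])

lemma twist_velocity_has_vector_derivative:
  "(twist_velocity \<zeta> k x v has_vector_derivative twist_acceleration \<zeta> k x v) (at 0)"
proof -
  have gc: "(great_circle x v has_vector_derivative v) (at 0)"
    using great_circle_has_vector_derivative[of x v 0] by simp
  have ph: "(phase \<zeta> k has_vector_derivative \<i> * of_real k * \<zeta>) (at 0)"
    using phase_has_vector_derivative[of \<zeta> k 0] by (simp add: phase_velocity_def)
  have "(twist_velocity \<zeta> k x v has_vector_derivative
      (twist (phase \<zeta> k 0) (- (norm v)\<^sup>2 *\<^sub>R x) + twist (\<i> * of_real k * \<zeta>) (great_circle_velocity x v 0)) +
      (twist (phase_velocity \<zeta> k 0) v +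
        twist (phase_acceleration \<zeta> k) (great_circle x v 0))) (at 0)"
    unfolding twist_velocity_def
    by (intro has_vector_derivative_add bounded_bilinear.has_vector_derivative[OF bounded_bilinear_twist]
        gc ph phase_velocity_has_vector_derivative great_circle_velocity_has_vector_derivative)
  moreover have "(twist (phase \<zeta> k 0) (- (norm v)\<^sup>2 *\<^sub>R x) + twist (\<i> * of_real k * \<zeta>) (great_circle_velocity x v 0)) +
      (twist (phase_velocity \<zeta> k 0) v +
        twist (phase_acceleration \<zeta> k) (great_circle x v 0)) = twist_acceleration \<zeta> k x v"
    by (simp add: twist_acceleration_def phase_velocity_def phase_acceleration_def twist_def power2_eq_square algebra_simps)
       (simp add: scaleR_add_left[symmetric])
  ultimately show ?thesis by (simp only:)
qed

lemma inner_i_mult: "(\<i> * of_real k * \<zeta>) \<bullet> \<zeta> = 0" "\<zeta> \<bullet> (\<i> * of_real k * \<zeta>) = 0"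
  "(\<i> * of_real k * \<zeta>) \<bullet> (\<i> * of_real k' * \<zeta>) = k * k' * (\<zeta> \<bullet> \<zeta>)"
  by (simp_all add: inner_complex_def algebra_simps)

lemma inner_twist_velocity_self:
  assumes "norm \<zeta> = 1" "norm x = 1" "v \<bullet> x = 0"
  shows "twist_velocity \<zeta> k x v 0 \<bullet> twist_velocity \<zeta> k x v 0 = k\<^sup>2 + (norm v)\<^sup>2"
proof -
  have "\<zeta> \<bullet> \<zeta> = 1" "x \<bullet> x = 1" "x \<bullet> v = 0" using assms by (auto simp: norm_eq_1 inner_commute)
  with assms(3) show ?thesis
    by (simp add: twist_velocity_def phase_velocity_def inner_add_left inner_add_right inner_twist inner_i_mult
        power2_norm_eq_inner) (simp add: power2_eq_square)
qed

text \<open>The two summands are orthogonal because \<open>v \<bullet> x = 0\<close>. The value is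
  the mean of \<open>(norm v + k)^4\<close> and \<open>(norm v - k)^4\<close>, just as for a pair of
  characters whose first frequency is 1 and -1.\<close>

lemma inner_twist_acceleration_self:
  assumes "norm \<zeta> = 1" "norm x = 1" "v \<bullet> x = 0"
  shows "twist_acceleration \<zeta> k x v \<bullet> twist_acceleration \<zeta> k x v
    = (k\<^sup>2 + (norm v)\<^sup>2)\<^sup>2 + 4 * k\<^sup>2 * (norm v)\<^sup>2"
proof -
  have *: "\<zeta> \<bullet> \<zeta> = 1" "x \<bullet> x = 1" "x \<bullet> v = 0" using assms by (auto simp: norm_eq_1 inner_commute)
  have "(of_real a * \<zeta>) \<bullet> (of_real a * \<zeta>) = a\<^sup>2" for a
  proof -
    have "(of_real a * \<zeta>) \<bullet> (of_real a * \<zeta>) = a\<^sup>2 * (\<zeta> \<bullet> \<zeta>)"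
      by (simp add: inner_complex_def algebra_simps power2_eq_square)
    then show ?thesis using *(1) by simp
  qed
  moreover have "(2 * \<i> * of_real k * \<zeta>) \<bullet> (2 * \<i> * of_real k * \<zeta>) = 4 * k\<^sup>2"
    using *(1) inner_i_mult(3)[of "2 * k" \<zeta> "2 * k"] by (simp add: mult_ac power2_eq_square)
  ultimately show ?thesis
    using assms(3) *
    by (simp add: twist_acceleration_def inner_add_left inner_add_right inner_twist
        power2_norm_eq_inner del: of_real_add)
qed

text \<open>Each of the four cross terms has a vanishing factor: either a multiple of
  \<open>\<i> * \<zeta>\<close> against one of \<open>\<zeta>\<close>, or a tangent vector against
  \<open>x\<close>.\<close>

lemma twist_velocity_orthogonal:
  assumes "norm \<zeta> = 1" "norm x = 1" "v \<bullet> x = 0" "v' \<bullet> x = 0"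
  shows "twist_velocity \<zeta> k' x v' 0 \<bullet> twist_acceleration \<zeta> k x v = 0"
proof -
  have *: "x \<bullet> v = 0" using assms by (auto simp: norm_eq_1 inner_commute)
  have "(\<i> * of_real k' * \<zeta>) \<bullet> (of_real a * \<zeta>) = 0" "\<zeta> \<bullet> (2 * \<i> * of_real a * \<zeta>) = 0" for a
    by (simp_all add: inner_complex_def algebra_simps)
  then show ?thesis
    using assms(3,4) *
    by (simp add: twist_velocity_def phase_velocity_def twist_acceleration_def inner_add_left inner_add_right inner_twist
        del: of_real_add)
qed

text \<open>
  On \<open>S\<^sup>1 \<times> T\<^sup>2\<close> the norm dual to the metric is \<open>|(h, a)|\<^sup>2 = (9/5) h\<^sup>2 + (3/250) |a|\<^sup>2\<close>. All
  frequencies have length \<open>\<surd>3\<close> since \<open>10\<^sup>2 = 100\<close> and \<open>15\<^sup>2 + 5\<^sup>2 = 13\<^sup>2 + 9\<^sup>2 = 250\<close>. The weights solve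
  the remaining moment equations; \<open>(15, 5)\<close> and its reflections alone would not suffice, as these
  force \<open>cos 4\<phi> = 7/25\<close> for the polar angle \<open>\<phi>\<close> while the mean has to be \<open>- 1/5\<close>.
\<close>

definition design_vector ::
  "(int \<Rightarrow> int \<Rightarrow> 'a::euclidean_space \<times> 'a) \<Rightarrow> (int \<Rightarrow> int \<Rightarrow> complex) \<Rightarrow>
    ('a \<times> 'a) \<times> ('a \<times> 'a) \<times> complex \<times> complex \<times> complex \<times> complex \<times> complex \<times> complex" where
  "design_vector g h =
    (sqrt (5/18) *\<^sub>R g 10 0, sqrt (5/18) *\<^sub>R g 0 10,
     sqrt (37/1008) *\<^sub>R h 15 5, sqrt (37/1008) *\<^sub>R h 15 (-5),
     sqrt (71/864) *\<^sub>R h 5 15, sqrt (71/864) *\<^sub>R h 5 (-15),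
     sqrt (625/6048) *\<^sub>R h 13 9, sqrt (625/6048) *\<^sub>R h 13 (-9))"

text \<open>Weights enter the map under square roots and therefore appear linearly in inner
  products.\<close>

lemma inner_sqrt_scaleR:
  "c \<ge> 0 \<Longrightarrow> (sqrt c *\<^sub>R a) \<bullet> (sqrt c *\<^sub>R b) = c * (a \<bullet> b)"
  by (simp only: inner_scaleR_left inner_scaleR_right mult.assoc[symmetric] real_sqrt_mult_self abs_of_nonneg)

lemma inner_design_vector:
  "design_vector g h \<bullet> design_vector g' h' =
    5/18 * (g 10 0 \<bullet> g' 10 0 + g 0 10 \<bullet> g' 0 10) +
    37/1008 * (h 15 5 \<bullet> h' 15 5 + h 15 (-5) \<bullet> h' 15 (-5)) +
    71/864 * (h 5 15 \<bullet> h' 5 15 + h 5 (-15) \<bullet> h' 5 (-15)) +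
    625/6048 * (h 13 9 \<bullet> h' 13 9 + h 13 (-9) \<bullet> h' 13 (-9))"
  unfolding design_vector_def inner_Pair by (simp only: inner_sqrt_scaleR) (simp add: algebra_simps add_divide_distrib)

lemma design_vector_has_vector_derivative:
  assumes "\<And>m l. ((\<lambda>t. g t m l) has_vector_derivative g' m l) (at t0)"
    "\<And>m l. ((\<lambda>t. h t m l) has_vector_derivative h' m l) (at t0)"
  shows "((\<lambda>t. design_vector (g t) (h t)) has_vector_derivative design_vector g' h') (at t0)"
  unfolding design_vector_def
  by (intro has_vector_derivative_Pair bounded_linear.has_vector_derivative[OF bounded_linear_scaleR_right] assms)

lemma smooth_on_design_vector:
  assumes "open S" "\<And>m l. smooth_on S (\<lambda>x. g x m l)" "\<And>m l. smooth_on S (\<lambda>x. h x m l)"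
  shows "smooth_on S (\<lambda>x. design_vector (g x) (h x))"
  unfolding design_vector_def
  by (intro smooth_on_Pair smooth_on_linear_compose[OF bounded_linear_scaleR_right] assms)

section \<open>The design map and its derivatives along curves\<close>

definition design_map ::
  "'a::euclidean_space \<times> complex \<times> complex \<Rightarrow>
    ('a \<times> 'a) \<times> ('a \<times> 'a) \<times> complex \<times> complex \<times> complex \<times> complex \<times> complex \<times> complex" where
  "design_map = (\<lambda>(x, z, w).
    design_vector (\<lambda>m l. twist (character z w m l) x) (character z w))"

lemma smooth_on_design_map: "smooth_on UNIV design_map"
proof -
  have l: "bounded_linear (\<lambda>p::'a \<times> complex \<times> complex. fst (snd p))"
    "bounded_linear (\<lambda>p::'a \<times> complex \<times> complex. snd (snd p))"
    by (rule bounded_linear_fst_comp bounded_linear_snd_comp, rule bounded_linear_snd)+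
  have ch: "smooth_on UNIV (\<lambda>p::'a \<times> complex \<times> complex. character (fst (snd p)) (snd (snd p)) m l)" for m l
    unfolding character_def
    by (intro smooth_on_bilinear[OF bounded_bilinear_mult] smooth_on_cpow smooth_on_bounded_linear l open_UNIV)
  have "smooth_on UNIV (\<lambda>p::'a \<times> complex \<times> complex.
      design_vector (\<lambda>m l. twist (character (fst (snd p)) (snd (snd p)) m l) (fst p))
        (character (fst (snd p)) (snd (snd p))))"
    by (intro smooth_on_design_vector ch smooth_on_bilinear[OF bounded_bilinear_twist]
        smooth_on_bounded_linear bounded_linear_fst open_UNIV)
  then show ?thesis unfolding design_map_def case_prod_unfold .
qed

text \<open>The weights sum to 1: twice 5/18 is 5/9, and twice
  \<open>37/1008 + 71/864 + 625/6048\<close> is 4/9.\<close>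

lemma norm_design_map:
  assumes "norm x = 1" "norm z = 1" "norm w = 1"
  shows "norm (design_map (x, z, w)) = 1"
proof -
  have [simp]: "character z w m l \<bullet> character z w m l = 1" for m l
    using norm_character[OF assms(2,3)] by (simp add: norm_eq_1)
  have [simp]: "x \<bullet> x = 1" using assms by (simp add: norm_eq_1)
  show ?thesis by (simp add: design_map_def norm_eq_1 inner_design_vector inner_twist)
qed

definition design_velocity where
  "design_velocity x z w v s r t = design_vector
    (\<lambda>m l. twist_velocity (character z w m l) (of_int m * s + of_int l * r) x v t)
    (\<lambda>m l. phase_velocity (character z w m l) (of_int m * s + of_int l * r) t)"

definition design_acceleration where
  "design_acceleration x z w v s r = design_vector
    (\<lambda>m l. twist_acceleration (character z w m l) (of_int m * s + of_int l * r) x v)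
    (\<lambda>m l. phase_acceleration (character z w m l) (of_int m * s + of_int l * r))"

lemma design_map_curve:
  "design_map (great_circle x v t, phase z s t, phase w r t) = design_vector
    (\<lambda>m l. twist (phase (character z w m l) (of_int m * s + of_int l * r) t) (great_circle x v t))
    (\<lambda>m l. phase (character z w m l) (of_int m * s + of_int l * r) t)"
  unfolding phase_def design_map_def by (simp add: character_curve[abs_def])

lemma design_map_has_vector_derivative:
  "((\<lambda>t. design_map (great_circle x v t, phase z s t, phase w r t)) has_vector_derivative
    design_velocity x z w v s r t) (at t)"
  unfolding design_map_curve design_velocity_def
  by (intro design_vector_has_vector_derivative twist_has_vector_derivative
      phase_has_vector_derivative)

lemma design_velocity_has_vector_derivative:
  "(design_velocity x z w v s r has_vector_derivative design_acceleration x z w v s r) (at 0)"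
  unfolding design_velocity_def[abs_def] design_acceleration_def
  by (intro design_vector_has_vector_derivative twist_velocity_has_vector_derivative
      phase_velocity_has_vector_derivative)

text \<open>With \<open>L\<close> the squared norm of \<open>v\<close>, the right-hand side is the
  pullback metric. Reflected frequencies cancel the mixed term in \<open>s * r\<close>, and the
  weights make the two torus directions equal.\<close>

lemma design_moment_2:
  fixes s r L :: real
  shows "5/18 * ((10 * s)\<^sup>2 + L + ((10 * r)\<^sup>2 + L)) +
    37/1008 * ((15 * s + 5 * r)\<^sup>2 + (15 * s - 5 * r)\<^sup>2) +
    71/864 * ((5 * s + 15 * r)\<^sup>2 + (5 * s - 15 * r)\<^sup>2) +
    625/6048 * ((13 * s + 9 * r)\<^sup>2 + (13 * s - 9 * r)\<^sup>2) = 5/9 * L + 250/3 * (s\<^sup>2 + r\<^sup>2)"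
  by (simp add: power2_eq_square algebra_simps)

text \<open>This is the 4-design property as a polynomial identity. The factor 9/5 is the mean of
  the fourth power of a coordinate on the 2-sphere of radius \<open>sqrt 3\<close>, namely 9 times
  1/5.\<close>

lemma design_moment_4:
  fixes s r L :: real
  shows "5/18 * (((10 * s)\<^sup>2 + L)\<^sup>2 + 4 * (10 * s)\<^sup>2 * L + (((10 * r)\<^sup>2 + L)\<^sup>2 + 4 * (10 * r)\<^sup>2 * L)) +
    37/1008 * (((15 * s + 5 * r)\<^sup>2)\<^sup>2 + ((15 * s - 5 * r)\<^sup>2)\<^sup>2) +
    71/864 * (((5 * s + 15 * r)\<^sup>2)\<^sup>2 + ((5 * s - 15 * r)\<^sup>2)\<^sup>2) +
    625/6048 * (((13 * s + 9 * r)\<^sup>2)\<^sup>2 + ((13 * s - 9 * r)\<^sup>2)\<^sup>2) =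
    9/5 * (5/9 * L + 250/3 * (s\<^sup>2 + r\<^sup>2))\<^sup>2"
  by (simp add: power2_eq_square algebra_simps)

context
  fixes x :: "'a::euclidean_space" and z w :: complex
  assumes unit: "norm x = 1" "norm z = 1" "norm w = 1"
begin

lemma norm_design_velocity:
  assumes "v \<bullet> x = 0"
  shows "(norm (design_velocity x z w v s r 0))\<^sup>2 = 5/9 * (norm v)\<^sup>2 + 250/3 * (s\<^sup>2 + r\<^sup>2)"
proof -
  have "design_velocity x z w v s r 0 \<bullet> design_velocity x z w v s r 0 = 5/9 * (norm v)\<^sup>2 + 250/3 * (s\<^sup>2 + r\<^sup>2)"
    unfolding design_velocity_def inner_design_vector
      inner_phase_velocity_acceleration[OF norm_character[OF unit(2,3)]]
      inner_twist_velocity_self[OF norm_character[OF unit(2,3)] unit(1) assms]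
    using design_moment_2[of s "(norm v)\<^sup>2" r]
    by simp
  then show ?thesis by (simp only: power2_norm_eq_inner)
qed

lemma norm_design_acceleration:
  assumes "v \<bullet> x = 0"
  shows "(norm (design_acceleration x z w v s r))\<^sup>2 =
    9/5 * (5/9 * (norm v)\<^sup>2 + 250/3 * (s\<^sup>2 + r\<^sup>2))\<^sup>2"
proof -
  have "design_acceleration x z w v s r \<bullet> design_acceleration x z w v s r = 9/5 * (5/9 * (norm v)\<^sup>2 + 250/3 * (s\<^sup>2 + r\<^sup>2))\<^sup>2"
    unfolding design_acceleration_def inner_design_vector
      inner_phase_velocity_acceleration[OF norm_character[OF unit(2,3)]]
      inner_twist_acceleration_self[OF norm_character[OF unit(2,3)] unit(1) assms]
    using design_moment_4[of s "(norm v)\<^sup>2" r]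
    by simp
  then show ?thesis by (simp only: power2_norm_eq_inner)
qed

lemma design_velocity_orthogonal:
  assumes "v \<bullet> x = 0" "v' \<bullet> x = 0"
  shows "design_velocity x z w v' s' r' 0 \<bullet> design_acceleration x z w v s r = 0"
  unfolding design_velocity_def design_acceleration_def inner_design_vector
    inner_phase_velocity_acceleration[OF norm_character[OF unit(2,3)]]
    twist_velocity_orthogonal[OF norm_character[OF unit(2,3)] unit(1) assms]
  by simp

end

subsection \<open>The immersion and its curvature\<close>

definition sphere_torus :: "('a::euclidean_space \<times> complex \<times> complex) set" where
  "sphere_torus = sphere 0 1 \<times> (sphere 0 1 \<times> sphere 0 1)"

lemma tangent_space_sphere_torus:
  assumes "(x, z, w) \<in> sphere_torus"
  shows "tangent_space sphere_torus (x, z, w) = {v. v \<bullet> x = 0} \<times> {v. v \<bullet> z = 0} \<times> {v. v \<bullet> w = 0}"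
  using assms unfolding sphere_torus_def tangent_space_Times by (simp add: tangent_space_sphere)

lemma subspace_tangent_space_sphere_torus:
  assumes "p \<in> sphere_torus"
  shows "subspace (tangent_space sphere_torus p)"
proof -
  obtain x z w where p: "p = (x, z, w)" by (cases p)
  show ?thesis
    using assms unfolding p
    by (auto simp: tangent_space_sphere_torus subspace_def inner_add_left zero_prod_def)
qed

lemma tangent_circle:
  assumes "norm z = 1" "u \<bullet> z = 0"
  obtains s where "u = phase_velocity z s 0"
proof
  have 1: "Re z * Re z + Im z * Im z = 1"
    using assms(1) cmod_power2[of z] by (simp add: power2_eq_square)
  have 2: "Re u * Re z + Im u * Im z = 0" using assms(2) by (simp add: inner_complex_def)
  \<comment> \<open>The tangent line of the circle is spanned by the unit vector
    \<open>\<i> * z\<close>; the angular speed is the coefficient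
    \<open>u \<bullet> (\<i> * z)\<close>.\<close>
  show "u = phase_velocity z (Im u * Re z - Re u * Im z) 0"
  proof (rule complex_eqI)
    have "Re u * (Re z * Re z + Im z * Im z) = - (Im u * Re z - Re u * Im z) * Im z"
      using 2 by algebra
    then show "Re u = Re (phase_velocity z (Im u * Re z - Re u * Im z) 0)"
      unfolding 1 by (simp add: phase_velocity_def algebra_simps)
    have "Im u * (Re z * Re z + Im z * Im z) = (Im u * Re z - Re u * Im z) * Re z"
      using 2 by algebra
    then show "Im u = Im (phase_velocity z (Im u * Re z - Re u * Im z) 0)"
      unfolding 1 by (simp add: phase_velocity_def algebra_simps)
  qed
qed

text \<open>Thus every tangent vector is the initial velocity of a great circle combined with two
  rotations, and computations along such curves cover the whole tangent space.\<close>

lemma tangent_sphere_torus_cases: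
  assumes "(x, z, w) \<in> sphere_torus" "u \<in> tangent_space sphere_torus (x, z, w)"
  obtains v s r where "v \<bullet> x = 0" "u = (v, phase_velocity z s 0, phase_velocity w r 0)"
  using assms unfolding tangent_space_sphere_torus[OF assms(1)]
  by (auto simp: sphere_torus_def elim!: tangent_circle)

text \<open>Projecting constant vectors factor by factor gives the extension. Its existence ensures
  that the choice in \<open>second_fundamental_form\<close> yields a genuine tangent field.\<close>

lemma tangent_field_sphere_torus:
  assumes p: "p \<in> sphere_torus" and u: "u \<in> tangent_space sphere_torus p"
  shows "\<exists>V. tangent_field sphere_torus V \<and> V p = u"
proof -
  obtain x z w where p': "p = (x, z, w)" by (cases p)
  obtain u1 u2 u3 where u': "u = (u1, u2, u3)" by (cases u)
  define V where "V = (\<lambda>q. (sphere_projection u1 (fst q), sphere_projection u2 (fst (snd q)),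
    sphere_projection u3 (snd (snd q))))"
  have "smooth_on UNIV V"
    unfolding V_def
    by (intro smooth_on_Pair smooth_on_sphere_projection bounded_linear_fst open_UNIV)
      (rule bounded_linear_fst_comp bounded_linear_snd_comp, rule bounded_linear_snd)+
  moreover have "V q \<in> tangent_space sphere_torus q" if "q \<in> sphere_torus" for q
  proof -
    obtain a b c where q: "q = (a, b, c)" by (cases q)
    have "norm a = 1" "norm b = 1" "norm c = 1"
      using that by (simp_all add: q sphere_torus_def)
    then show ?thesis
      using that unfolding q
      by (simp add: tangent_space_sphere_torus V_def sphere_projection_orthogonal)
  qed
  moreover have "V p = u"
    using u p unfolding p' u' by (simp add: tangent_space_sphere_torus V_def sphere_projection_id)
  ultimately show ?thesis
    unfolding tangent_field_def using smooth_map_onI by blast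
qed

section \<open>Products of a great circle and two rotations\<close>

definition torus_curve where
  "torus_curve x v z w s r t = (great_circle x v t, phase z s t, phase w r t)"

definition torus_curve_velocity where
  "torus_curve_velocity x v z w s r t = (great_circle_velocity x v t, phase_velocity z s t, phase_velocity w r t)"

lemma torus_curve_0 [simp]: "torus_curve x v z w s r 0 = (x, z, w)"
  by (simp add: torus_curve_def)

lemma torus_curve_velocity_0 [simp]:
  "torus_curve_velocity x v z w s r 0 = (v, phase_velocity z s 0, phase_velocity w r 0)"
  by (simp add: torus_curve_velocity_def)

lemma torus_curve_has_vector_derivative:
  "(torus_curve x v z w s r has_vector_derivative torus_curve_velocity x v z w s r t) (at t)"
  unfolding torus_curve_def[abs_def] torus_curve_velocity_def great_circle_velocity_def
  by (intro has_vector_derivative_Pair great_circle_has_vector_derivative phase_has_vector_derivative)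

lemma torus_curve_velocity_has_vector_derivative:
  "(torus_curve_velocity x v z w s r has_vector_derivative
    (- (norm v)\<^sup>2 *\<^sub>R x, phase_acceleration z s, phase_acceleration w r)) (at 0)"
  unfolding torus_curve_velocity_def[abs_def]
  by (intro has_vector_derivative_Pair great_circle_velocity_has_vector_derivative
      phase_velocity_has_vector_derivative)

context
  fixes x v :: "'a::euclidean_space" and z w :: complex and s r :: real
  assumes p: "(x, z, w) \<in> sphere_torus" and v: "v \<bullet> x = 0"
begin

lemma torus_curve_mem: "torus_curve x v z w s r t \<in> sphere_torus"
  using p great_circle_on_sphere[OF _ v, of t]
  by (simp add: sphere_torus_def torus_curve_def phase_def norm_mult)

lemma torus_curve_velocity_tangent: "torus_curve_velocity x v z w s r t \<in> tangent_space sphere_torus (torus_curve x v z w s r t)"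
proof -
  have "(norm x)\<^sup>2 = 1" using p by (simp add: sphere_torus_def)
  then have xx: "x \<bullet> x = 1" by (simp add: power2_norm_eq_inner)
  have "great_circle_velocity x v t \<bullet> great_circle x v t = 0"
  proof (cases "v = 0")
    case False
    then have "v \<bullet> v / norm v = norm v" by (simp add: power2_norm_eq_inner[symmetric] power2_eq_square)
    then show ?thesis
      using v xx inner_commute[of x v]
      by (simp add: great_circle_velocity_def great_circle_def inner_diff_left inner_add_right
          divide_inverse mult_ac)
  qed (simp add: great_circle_velocity_def)
  moreover have "phase_velocity y k t \<bullet> phase y k t = 0" for y k
    by (simp add: phase_velocity_def mult.assoc inner_i_mult(1)[unfolded mult.assoc])
  ultimately show ?thesis
    using torus_curve_mem unfolding torus_curve_def torus_curve_velocity_def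
    by (subst tangent_space_sphere_torus) auto
qed

text \<open>Tangency says that each component of \<open>D\<close> is orthogonal to that of the
  curve. Differentiating this at 0, the term with the velocity of the curve drops out because
  \<open>D 0 = 0\<close>.\<close>

lemma tangent_along_torus_curve:
  assumes D: "\<And>t. D t \<in> tangent_space sphere_torus (torus_curve x v z w s r t)" and D0: "D 0 = 0"
    and d: "(D has_vector_derivative d) (at 0)"
  shows "d \<in> tangent_space sphere_torus (torus_curve x v z w s r 0)"
proof -
  have orth: "e \<bullet> y 0 = 0"
    if "\<And>t. E t \<bullet> y t = 0" "E 0 = 0" "(E has_vector_derivative e) (at 0)"
      "(y has_vector_derivative y') (at 0)" for E y :: "real \<Rightarrow> 'z::euclidean_space" and e y'
  proof -
    have "((\<lambda>t. E t \<bullet> y t) has_derivative (\<lambda>h. h * (e \<bullet> y 0))) (at 0)"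
      using that(3,4) unfolding has_vector_derivative_def
      by (auto intro!: derivative_eq_intros simp: that(2))
    moreover have "((\<lambda>t. E t \<bullet> y t) has_derivative (\<lambda>h. 0)) (at 0)"
      unfolding that(1) by (rule has_derivative_const)
    ultimately have "(\<lambda>h. h * (e \<bullet> y 0)) = (\<lambda>h. 0)" by (rule has_derivative_unique)
    from fun_cong[OF this, of 1] show ?thesis by simp
  qed
  have c: "(torus_curve x v z w s r has_vector_derivative torus_curve_velocity x v z w s r 0) (at 0)"
    by (rule torus_curve_has_vector_derivative)
  have D': "fst (D t) \<bullet> fst (torus_curve x v z w s r t) = 0"
    "fst (snd (D t)) \<bullet> fst (snd (torus_curve x v z w s r t)) = 0"
    "snd (snd (D t)) \<bullet> snd (snd (torus_curve x v z w s r t)) = 0" for t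
    using D[of t] torus_curve_mem[of t]
    by (cases "torus_curve x v z w s r t"; cases "D t"; auto simp: tangent_space_sphere_torus)+
  note lin = bounded_linear_fst bounded_linear_compose[OF bounded_linear_fst bounded_linear_snd]
    bounded_linear_compose[OF bounded_linear_snd bounded_linear_snd]
  have "fst d \<bullet> fst (torus_curve x v z w s r 0) = 0"
    by (rule orth[OF D'(1)]) (auto intro: bounded_linear.has_vector_derivative[OF lin(1)] c d simp: D0)
  moreover have "fst (snd d) \<bullet> fst (snd (torus_curve x v z w s r 0)) = 0"
    by (rule orth[OF D'(2)]) (auto intro: bounded_linear.has_vector_derivative[OF lin(2)] c d simp: D0)
  moreover have "snd (snd d) \<bullet> snd (snd (torus_curve x v z w s r 0)) = 0"
    by (rule orth[OF D'(3)]) (auto intro: bounded_linear.has_vector_derivative[OF lin(3)] c d simp: D0)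
  ultimately show ?thesis
    using p by (cases d) (simp add: tangent_space_sphere_torus)
qed

end

lemma norm_sphere_torus:
  assumes "(x, z, w) \<in> sphere_torus"
  shows "norm x = 1" "norm z = 1" "norm w = 1"
  using assms by (simp_all add: sphere_torus_def)

text \<open>\<open>J\<close> places the target of \<open>design_map\<close> isometrically and
  linearly into the prescribed Euclidean space, so all lengths and angles computed above
  persist.\<close>

locale design_embedding =
  fixes J :: "('a::euclidean_space \<times> 'a) \<times> ('a \<times> 'a) \<times>
      complex \<times> complex \<times> complex \<times> complex \<times> complex \<times> complex \<Rightarrow> 'b::euclidean_space"
  assumes linear_J: "linear J" and norm_J: "norm (J y) = norm y"
begin

lemma bounded_linear_J: "bounded_linear J"
  using linear_J by (rule linear_conv_bounded_linear[THEN iffD1])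

text \<open>Polarization recovers inner products from norms.\<close>

lemma inner_J: "J a \<bullet> J b = a \<bullet> b"
  unfolding dot_norm by (simp add: norm_J linear_add[OF linear_J, symmetric])

definition f where "f p = J (design_map p)"

lemma smooth_on_f: "smooth_on UNIV f"
  unfolding f_def[abs_def]
  by (rule smooth_on_linear_compose[OF bounded_linear_J open_UNIV smooth_on_design_map])

lemma f_curve:
  "((\<lambda>t. f (torus_curve x v z w s r t)) has_vector_derivative J (design_velocity x z w v s r t)) (at t)"
  unfolding f_def torus_curve_def
  by (intro bounded_linear.has_vector_derivative[OF bounded_linear_J] design_map_has_vector_derivative)

context
  fixes x v :: 'a and z w :: complex and s r :: real
  assumes p: "(x, z, w) \<in> sphere_torus" and v: "v \<bullet> x = 0"
begin

lemma velocity_tangent: "(v, phase_velocity z s 0, phase_velocity w r 0) \<in> tangent_space sphere_torus (x, z, w)"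
  using torus_curve_velocity_tangent[OF p v, of s r 0]
  by (simp add: torus_curve_velocity_def torus_curve_def)

lemma differential_f:
  "differential sphere_torus f (x, z, w) (v, phase_velocity z s 0, phase_velocity w r 0) =
    J (design_velocity x z w v s r 0)"
proof -
  let ?c = "torus_curve x v z w s r" and ?u = "(v, phase_velocity z s 0, phase_velocity w r 0)"
  have c: "(?c has_derivative (\<lambda>h. h *\<^sub>R ?u)) (at 0)"
    using torus_curve_has_vector_derivative[of x v z w s r 0]
    by (simp add: torus_curve_velocity_def has_vector_derivative_def)
  have "?c 0 = (x, z, w)" by simp
  moreover have D: "(f has_derivative frechet_derivative f (at (?c 0))) (at (?c 0))"
    by (rule smooth_on_has_derivative[OF smooth_on_f]) simp
  ultimately have "((\<lambda>t. f (?c t)) has_vector_derivative frechet_derivative f (at (x, z, w)) ?u) (at 0)"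
    using has_derivative_compose[OF c D] linear_cmul[OF has_derivative_linear[OF D]]
    by (simp add: has_vector_derivative_def del: scaleR_Pair)
  then have "frechet_derivative f (at (x, z, w)) ?u = J (design_velocity x z w v s r 0)"
    using f_curve vector_derivative_unique_at by blast
  then show ?thesis using differential_smooth[OF smooth_on_f velocity_tangent] by simp
qed

end

text \<open>Nothing has to be projected away: the acceleration of the image curve is already
  orthogonal to the image of the tangent space, so the curve criterion applies directly.\<close>

lemma second_fundamental_form_f:
  fixes x v :: 'a and z w :: complex and s r :: real
  assumes p: "(x, z, w) \<in> sphere_torus" and v: "v \<bullet> x = 0"
  shows
  "second_fundamental_form sphere_torus f (x, z, w)
    (v, phase_velocity z s 0, phase_velocity w r 0) (v, phase_velocity z s 0, phase_velocity w r 0) =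
    J (design_acceleration x z w v s r)"
proof -
  let ?c = "torus_curve x v z w s r" and ?c' = "torus_curve_velocity x v z w s r"
  have 0: "?c 0 = (x, z, w)" "?c' 0 = (v, phase_velocity z s 0, phase_velocity w r 0)"
    by simp_all
  have "second_fundamental_form sphere_torus f (?c 0) (?c' 0) (?c' 0) =
      J (design_acceleration x z w v s r)"
  proof (rule second_fundamental_form_eq_curve[OF smooth_on_f])
    show "subspace (tangent_space sphere_torus (?c t))" for t
      by (intro subspace_tangent_space_sphere_torus torus_curve_mem p v)
    show "\<exists>V. tangent_field sphere_torus V \<and> V (?c 0) = ?c' 0"
      unfolding 0 by (rule tangent_field_sphere_torus[OF p velocity_tangent[OF p v]])
    show "((\<lambda>t. J (design_velocity x z w v s r t)) has_vector_derivative
        J (design_acceleration x z w v s r)) (at 0)"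
      by (intro bounded_linear.has_vector_derivative[OF bounded_linear_J]
          design_velocity_has_vector_derivative)
    \<comment> \<open>Normality concerns all tangent vectors, so \<open>u\<close> receives its own
      parameters \<open>v'\<close>, \<open>s'\<close>, \<open>r'\<close>, independent of those of
      the curve.\<close>
    have "differential sphere_torus f (x, z, w) u \<bullet> J (design_acceleration x z w v s r) = 0"
      if u: "u \<in> tangent_space sphere_torus (x, z, w)" for u
      using p u
    proof (cases rule: tangent_sphere_torus_cases)
      case (1 v' s' r')
      then show ?thesis
        using differential_f[OF p 1(1)] design_velocity_orthogonal[OF norm_sphere_torus[OF p] v 1(1)]
        by (simp add: inner_J)
    qed
    then show "J (design_acceleration x z w v s r) \<in>
        (differential sphere_torus f (?c 0) ` tangent_space sphere_torus (?c 0))\<^sup>\<bottom>"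
      unfolding 0 by (auto simp: orthogonal_comp_def orthogonal_def)
  qed (rule torus_curve_mem[OF p v] torus_curve_velocity_tangent[OF p v] torus_curve_has_vector_derivative
      torus_curve_velocity_has_vector_derivative f_curve | (rule tangent_along_torus_curve[OF p v]; assumption))+
  then show ?thesis unfolding 0 .
qed

text \<open>The quadratic form from \<open>norm_design_velocity\<close> is positive definite and
  \<open>J\<close> preserves norms, so the derivative has trivial kernel on each tangent
  space.\<close>

lemma immersion_on_f: "immersion_on sphere_torus f"
  unfolding immersion_on_def
proof (intro conjI ballI)
  show "smooth_map_on sphere_torus f" by (rule smooth_map_onI[OF smooth_on_f])
  fix p :: "'a \<times> complex \<times> complex" assume p: "p \<in> sphere_torus"
  obtain x z w where xzw: "p = (x, z, w)" by (cases p)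
  let ?T = "tangent_space sphere_torus p" and ?D = "frechet_derivative f (at p)"
  have D: "linear ?D"
    using smooth_on_has_derivative[OF smooth_on_f] has_derivative_linear by blast
  have "u = 0" if u: "u \<in> ?T" "?D u = 0" for u
    using p u(1) unfolding xzw
  proof (cases rule: tangent_sphere_torus_cases)
    case (1 v s r)
    have "J (design_velocity x z w v s r 0) = 0"
      using u differential_f[OF p[unfolded xzw] 1(1), of s r] differential_smooth[OF smooth_on_f u(1)]
      by (simp add: xzw 1(2))
    then have "norm (design_velocity x z w v s r 0) = 0"
      using norm_J[of "design_velocity x z w v s r 0"] by simp
    then have "5/9 * (norm v)\<^sup>2 + 250/3 * (s\<^sup>2 + r\<^sup>2) = 0"
      using norm_design_velocity[OF norm_sphere_torus[OF p[unfolded xzw]] 1(1), of s r] by simp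
    then have "v = 0 \<and> s = 0 \<and> r = 0"
      by (simp add: add_nonneg_eq_0_iff)
    then show ?thesis by (simp add: 1(2) phase_velocity_def zero_prod_def)
  qed
  then have "inj_on ?D ?T"
    using linear_injective_on_subspace_0[OF D subspace_tangent_space_sphere_torus[OF p]] by blast
  then show "inj_on (differential sphere_torus f p) ?T"
    by (rule inj_on_cong[THEN iffD1, rotated]) (simp add: differential_smooth[OF smooth_on_f])
qed

lemma f_in_cball: "f ` sphere_torus \<subseteq> cball 0 1"
  by (auto simp: f_def norm_J norm_design_map sphere_torus_def)

text \<open>On unit vectors the second moment equals 1, and the fourth moment then fixes the squared
  norm of the acceleration at 9/5: the normal curvature is the same in every direction.\<close>

lemma max_normal_curvature_f: "max_normal_curvature sphere_torus f \<le> ereal (sqrt (9 / 5))"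
  unfolding max_normal_curvature_def
proof (rule SUP_least, safe)
  fix x :: 'a and z w u1 u2 u3
  assume p: "(x, z, w) \<in> sphere_torus"
    and u: "(u1, u2, u3) \<in> tangent_space sphere_torus (x, z, w)"
    and 1: "norm (differential sphere_torus f (x, z, w) (u1, u2, u3)) = 1"
  obtain v s r where v: "v \<bullet> x = 0" and u_eq: "(u1, u2, u3) = (v, phase_velocity z s 0, phase_velocity w r 0)"
    using p u by (rule tangent_sphere_torus_cases)
  have "5/9 * (norm v)\<^sup>2 + 250/3 * (s\<^sup>2 + r\<^sup>2) = 1"
    using 1 norm_design_velocity[OF norm_sphere_torus[OF p] v, of s r]
    unfolding u_eq differential_f[OF p v] norm_J by simp
  then have "(norm (design_acceleration x z w v s r))\<^sup>2 = 9/5"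
    using norm_design_acceleration[OF norm_sphere_torus[OF p] v, of s r] by simp
  then have "norm (design_acceleration x z w v s r) = sqrt (9/5)"
    by (metis norm_ge_zero real_sqrt_unique)
  then show "ereal (norm (second_fundamental_form sphere_torus f (x, z, w) (u1, u2, u3) (u1, u2, u3)))
      \<le> ereal (sqrt (9 / 5))"
    unfolding u_eq second_fundamental_form_f[OF p v] norm_J by simp
qed

end

text \<open>Dimensions are cardinalities of index types: the unit sphere of \<open>real ^ 'k\<close>
  is the n-sphere, and \<open>real ^ 'm\<close> has dimension \<open>N\<close>. The infimum is
  bounded by its value at one immersion.\<close>

theorem proposition10:
  fixes n N :: nat
  assumes "n \<ge> 1"
    and "CARD('k::finite) = n + 1"
    and "CARD('m::finite) = N"
    and "N \<ge> 4 * n + 16"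
  shows "minimal_curvature TYPE(real ^ 'm)
           (sphere (0 :: real ^ 'k) 1 \<times> (sphere (0 :: complex) 1 \<times> sphere (0 :: complex) 1))
         \<le> ereal (sqrt (9 / 5))"
proof -
  \<comment> \<open>Four copies of \<open>real ^ 'k\<close> and six of \<open>complex\<close> have
    total dimension \<open>4 * (n + 1) + 12 = 4 * n + 16\<close>, which leaves room for a linear
    isometry into \<open>real ^ 'm\<close>.\<close>
  have "dim (UNIV :: (((real ^ 'k) \<times> (real ^ 'k)) \<times> ((real ^ 'k) \<times> (real ^ 'k)) \<times>
      complex \<times> complex \<times> complex \<times> complex \<times> complex \<times> complex) set) \<le> dim (UNIV :: (real ^ 'm) set)"
    using assms(2-4) by (simp add: dim_UNIV)
  then obtain J :: "((real ^ 'k) \<times> (real ^ 'k)) \<times> ((real ^ 'k) \<times> (real ^ 'k)) \<times>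
      complex \<times> complex \<times> complex \<times> complex \<times> complex \<times> complex \<Rightarrow> real ^ 'm"
    where J: "linear J" "\<And>y. norm (J y) = norm y"
    using isometry_subset_subspace[OF subspace_UNIV subspace_UNIV] by (metis UNIV_I)
  interpret design_embedding J
    by (rule design_embedding.intro[OF J])
  have "minimal_curvature TYPE(real ^ 'm) (sphere_torus :: ((real ^ 'k) \<times> complex \<times> complex) set)
      \<le> max_normal_curvature sphere_torus f"
    unfolding minimal_curvature_def
    by (rule INF_lower) (use immersion_on_f f_in_cball in auto)
  also note max_normal_curvature_f
  finally show ?thesis unfolding sphere_torus_def .
qed

end
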